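(* Let $d$ be a positive integer, and let $X$ be either $\mathbb{R}^d$ or a $d$-dimensional sphere $S^d_r$ of radius $r>1/\sqrt2$. Let $\Delta_1,\Delta_2\subset X$ be two unit regular simplices on $d$ vertices each. Then either $\Delta_1$ and $\Delta_2$ share at least $d-2$ vertices, or there are vertices $v_1\in\Delta_1$ and $v_2\in\Delta_2$ such that $\|v_1-v_2\|>1$.
   Context: A unit regular simplex on $d$ vertices in $X$ is a set of $d$ points of $X$ that are pairwise at Euclidean distance $1$. $S^d_r$ is a $d$-dimensional sphere of radius $r$ in $\mathbb{R}^{d+1}$, and $\|\cdot\|$ is the Euclidean norm (of the ambient space $\mathbb{R}^{d+1}$ in the spherical case). *)

theory Defs
  imports "HOL-Analysis.Analysis"
begin

definition unit_regular_simplex :: "nat \<Rightarrow> 'a::euclidean_space set \<Rightarrow> 'a set \<Rightarrow> bool" where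
  "unit_regular_simplex d X D \<longleftrightarrow>
     D \<subseteq> X \<and> finite D \<and> card D = d \<and> (\<forall>x\<in>D. \<forall>y\<in>D. x \<noteq> y \<longrightarrow> norm (x - y) = 1)"

end

theory Submission
  imports Defs
begin

text \<open>
  Assume that no vertex of one simplex is farther than \<open>1\<close> from a vertex of the other, and put
  \<open>N v w = 1 - (norm (v - w))\<^sup>2\<close> for \<open>v \<in> \<Delta>\<^sub>1\<close> and \<open>w \<in> \<Delta>\<^sub>2\<close>. This is a matrix with entries in
  \<open>[0, 1]\<close>, and an entry equal to \<open>1\<close> is a common vertex. The proof shows that at most two rows are
  without an entry \<open>1\<close>. Geometry enters in only two ways.

  \<^item> Positivity (\<open>simplex_gap\<close>): since both simplices are regular of edge length \<open>1\<close>, for weights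
    \<open>x\<close>, \<open>y\<close> on the vertices with equal sums, \<open>|x|\<^sup>2 + |y|\<^sup>2 - 2 (x \<bullet> N y)\<close> is twice the squared
    distance of the two weighted vertex sums, hence nonnegative.
  \<^item> Dependencies (\<open>equidistance_weights\<close>): the dimension of \<open>X\<close> forces every \<open>d + 2\<close> points of \<open>X\<close> to
    satisfy a dependency that makes the weighted sum of squared distances to a point \<open>p \<in> X\<close>
    independent of \<open>p\<close>. Applied to two vertices of \<open>\<Delta>\<^sub>1\<close> and all of \<open>\<Delta>\<^sub>2\<close>, this gives \<open>x\<close> with only
    two nonzero entries, \<open>y\<close>, and a constant \<open>\<kappa>\<close> with \<open>x = N y - \<kappa>\<close> and \<open>y = N\<^sup>T x + \<kappa>\<close>. The sums of
    \<open>x\<close> and \<open>y\<close> differ by \<open>\<epsilon> \<kappa>\<close> with a fixed \<open>\<epsilon> \<ge> 0\<close>; this sign is where the radius of the sphere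
    has to exceed \<open>1 / sqrt 2\<close>.

  The rest is about nonnegative matrices. Positivity implies that all rows or all columns have
  Euclidean norm at most \<open>1\<close> (\<open>row_or_column\<close>); by symmetry let it be the rows. If the two entries of
  \<open>x\<close> in a dependency have opposite signs, split \<open>(x, y)\<close> into its positive and its negative part.
  As in the discrete nodal domain theorem, \<open>N \<ge> 0\<close> makes the values of the quadratic form at the two
  parts add up to something nonpositive. Each part involves a single row, and such a row has norm at
  most \<open>1\<close>, so each value is also nonnegative. Both vanish, and therefore the two rows are unit
  vectors with disjoint supports (\<open>unit_rows_if_opposite_signs\<close>).

  Suppose now that three rows have no entry \<open>1\<close>. A row of norm \<open>1\<close> among them has entry sum greater
  than \<open>1\<close>, and at least two positive entries. If all these rows have norm \<open>1\<close>, the sum of all entries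
  of \<open>N\<close> exceeds \<open>d\<close>, against positivity at \<open>x = 1\<close>, \<open>y = 1\<close>. Otherwise some such row \<open>r\<close> has norm
  less than \<open>1\<close>; then the dependencies that pair \<open>r\<close> with two other rows \<open>k\<close> and \<open>l\<close> have entries of
  equal sign, and eliminating \<open>r\<close> between them gives a dependency with opposite signs at \<open>k\<close> and \<open>l\<close>.
  So all rows except \<open>r\<close> have disjoint supports, which need more than \<open>d\<close> columns
  (\<open>few_unmatched_rows\<close>).
\<close>

section \<open>Weights coupled by a nonnegative matrix\<close>

text \<open>
  For \<open>\<epsilon> > 0\<close> these are the stationary points, with critical value \<open>0\<close>, of the quadratic form
  \<open>|x|\<^sup>2 + |y|\<^sup>2 - 2 (x \<bullet> N y) + (sum x A - sum y B)\<^sup>2 / \<epsilon>\<close>. For \<open>\<epsilon> = 0\<close> they are those of the same form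
  without its last term, restricted to weights of equal sums, with \<open>\<kappa>\<close> as Lagrange multiplier. The
  parameter \<open>\<epsilon>\<close> treats the sphere and the Euclidean space, its limit, together.
\<close>

definition coupled_weights :: "'i set \<Rightarrow> 'j set \<Rightarrow> ('i \<Rightarrow> 'j \<Rightarrow> real) \<Rightarrow> real \<Rightarrow> ('i \<Rightarrow> real) \<Rightarrow> ('j \<Rightarrow> real) \<Rightarrow> real \<Rightarrow> bool" where
  "coupled_weights A B N \<epsilon> x y \<kappa> \<longleftrightarrow>
     (\<forall>i\<in>A. x i = (\<Sum>j\<in>B. N i j * y j) - \<kappa>) \<and>
     (\<forall>j\<in>B. y j = (\<Sum>i\<in>A. N i j * x i) + \<kappa>) \<and>
     sum x A - sum y B = \<epsilon> * \<kappa>"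

lemma coupled_weights_combine:
  assumes "coupled_weights A B N \<epsilon> x y \<kappa>" "coupled_weights A B N \<epsilon> x' y' \<kappa>'"
  shows "coupled_weights A B N \<epsilon> (\<lambda>i. s * x i + t * x' i) (\<lambda>j. s * y j + t * y' j) (s * \<kappa> + t * \<kappa>')"
proof -
  have 1: "(\<Sum>j\<in>B. N i j * (s * y j + t * y' j)) = s * (\<Sum>j\<in>B. N i j * y j) + t * (\<Sum>j\<in>B. N i j * y' j)" for i
    by (simp add: sum_distrib_left sum.distrib algebra_simps)
  have 2: "(\<Sum>i\<in>A. N i j * (s * x i + t * x' i)) = s * (\<Sum>i\<in>A. N i j * x i) + t * (\<Sum>i\<in>A. N i j * x' i)" for j
    by (simp add: sum_distrib_left sum.distrib algebra_simps)
  have 3: "sum (\<lambda>i. s * x i + t * x' i) A - sum (\<lambda>j. s * y j + t * y' j) B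
      = s * (sum x A - sum y B) + t * (sum x' A - sum y' B)"
    by (simp add: sum_distrib_left sum.distrib algebra_simps)
  have x: "x i = (\<Sum>j\<in>B. N i j * y j) - \<kappa>" "x' i = (\<Sum>j\<in>B. N i j * y' j) - \<kappa>'" if "i \<in> A" for i
    using assms that unfolding coupled_weights_def by blast+
  have y: "y j = (\<Sum>i\<in>A. N i j * x i) + \<kappa>" "y' j = (\<Sum>i\<in>A. N i j * x' i) + \<kappa>'" if "j \<in> B" for j
    using assms that unfolding coupled_weights_def by blast+
  have \<tau>: "sum x A - sum y B = \<epsilon> * \<kappa>" "sum x' A - sum y' B = \<epsilon> * \<kappa>'"
    using assms unfolding coupled_weights_def by blast+
  show ?thesis
    unfolding coupled_weights_def
  proof (intro conjI ballI)
    show "s * x i + t * x' i = (\<Sum>j\<in>B. N i j * (s * y j + t * y' j)) - (s * \<kappa> + t * \<kappa>')" if "i \<in> A" for i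
      unfolding 1 using arg_cong[OF x(1)[OF that], of "\<lambda>u. s * u"] arg_cong[OF x(2)[OF that], of "\<lambda>u. t * u"]
      by (simp only: right_diff_distrib, linarith?)
    show "s * y j + t * y' j = (\<Sum>i\<in>A. N i j * (s * x i + t * x' i)) + (s * \<kappa> + t * \<kappa>')" if "j \<in> B" for j
      unfolding 2 using arg_cong[OF y(1)[OF that], of "\<lambda>u. s * u"] arg_cong[OF y(2)[OF that], of "\<lambda>u. t * u"]
      by (simp only: distrib_left, linarith?)
    show "(\<Sum>i\<in>A. s * x i + t * x' i) - (\<Sum>j\<in>B. s * y j + t * y' j) = \<epsilon> * (s * \<kappa> + t * \<kappa>')"
      unfolding 3 \<tau> by (simp add: algebra_simps)
  qed
qed

text \<open>
  With \<open>Q (x, y) = |x|\<^sup>2 + |y|\<^sup>2 - 2 (x \<bullet> N y)\<close> and the positive and negative parts of \<open>(x, y)\<close>, the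
  equations give \<open>Q\<close> of the positive part plus \<open>Q\<close> of the negative part as \<open>- \<epsilon> * \<kappa>\<^sup>2\<close> minus twice
  the cross terms, which are nonnegative because \<open>N\<close> is. On the other hand each part has at most one
  nonzero \<open>x\<close>-entry, so its \<open>Q\<close> is a sum of squares as soon as that row has norm at most \<open>1\<close>. All these
  squares vanish. The case \<open>x k = 0\<close> is included because it rules out dependencies on one row.
\<close>

lemma unit_rows_if_opposite_signs:
  fixes N :: "'i \<Rightarrow> 'j \<Rightarrow> real"
  assumes fin: "finite A" "finite B" and ik: "i \<in> A" "k \<in> A" "i \<noteq> k"
    and N0: "\<And>i j. i \<in> A \<Longrightarrow> j \<in> B \<Longrightarrow> 0 \<le> N i j"
    and rows: "\<And>i. i \<in> A \<Longrightarrow> (\<Sum>j\<in>B. (N i j)\<^sup>2) \<le> 1"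
    and eps: "\<epsilon> \<ge> 0" and dep: "coupled_weights A B N \<epsilon> x y \<kappa>"
    and supp: "\<And>l. l \<in> A - {i,k} \<Longrightarrow> x l = 0"
    and sgn: "x i > 0" "x k \<le> 0"
  shows "(\<Sum>j\<in>B. (N i j)\<^sup>2) = 1"
    and "x k < 0 \<Longrightarrow> (\<Sum>j\<in>B. (N k j)\<^sup>2) = 1"
    and "\<And>j. j \<in> B \<Longrightarrow> y j = x i * N i j + x k * N k j"
    and "\<And>j. j \<in> B \<Longrightarrow> x k < 0 \<Longrightarrow> N i j = 0 \<or> N k j = 0"
proof -
  define p where "p = x i"
  define q where "q = - x k"
  define yp where "yp j = max (y j) 0" for j
  define ym where "ym j = max (- y j) 0" for j
  have pq: "p > 0" "q \<ge> 0" using sgn by (auto simp: p_def q_def)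
  have yy: "y j = yp j - ym j" "yp j \<ge> 0" "ym j \<ge> 0" "yp j * ym j = 0" for j
    by (auto simp: yp_def ym_def max_def)
  define a where "a = (\<Sum>j\<in>B. N i j * yp j)"
  define b where "b = (\<Sum>j\<in>B. N i j * ym j)"
  define c where "c = (\<Sum>j\<in>B. N k j * yp j)"
  define e where "e = (\<Sum>j\<in>B. N k j * ym j)"
  have nn: "b \<ge> 0" "c \<ge> 0"
    using N0 ik yy by (auto simp: b_def c_def intro!: sum_nonneg)
  have xi: "p = a - b - \<kappa>" and xk: "- q = c - e - \<kappa>"
    using dep ik unfolding coupled_weights_def p_def q_def a_def b_def c_def e_def
    by (auto simp: yy(1) sum_subtractf algebra_simps)
  have two: "sum f A = f i + f k" if "\<And>l. l \<in> A - {i,k} \<Longrightarrow> f l = 0" for f :: "'i \<Rightarrow> real"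
  proof -
    have "sum f A = sum f {i,k}"
      by (rule sum.mono_neutral_right) (use fin ik that in auto)
    then show ?thesis using ik by simp
  qed
  have yj: "y j = p * N i j - q * N k j + \<kappa>" if "j \<in> B" for j
  proof -
    have "(\<Sum>l\<in>A. N l j * x l) = N i j * x i + N k j * x k"
      by (rule two) (use supp in auto)
    moreover have "y j = (\<Sum>l\<in>A. N l j * x l) + \<kappa>"
      using dep that unfolding coupled_weights_def by blast
    ultimately show ?thesis by (simp add: p_def q_def algebra_simps)
  qed
  have "(yp j)\<^sup>2 = yp j * y j" for j
    by (simp add: yp_def max_def power2_eq_square)
  then have "(\<Sum>j\<in>B. (yp j)\<^sup>2) = (\<Sum>j\<in>B. yp j * (p * N i j - q * N k j + \<kappa>))"
    using yj by (auto intro!: sum.cong)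
  then have Sp: "(\<Sum>j\<in>B. (yp j)\<^sup>2) = p * a - q * c + \<kappa> * sum yp B"
    unfolding a_def c_def
    by (simp add: sum_distrib_left sum.distrib sum_subtractf algebra_simps)
  have "(ym j)\<^sup>2 = - ym j * y j" for j
    by (simp add: ym_def max_def power2_eq_square)
  then have "(\<Sum>j\<in>B. (ym j)\<^sup>2) = (\<Sum>j\<in>B. - ym j * (p * N i j - q * N k j + \<kappa>))"
    using yj by (auto intro!: sum.cong)
  then have Sm: "(\<Sum>j\<in>B. (ym j)\<^sup>2) = - p * b + q * e - \<kappa> * sum ym B"
    unfolding b_def e_def
    by (simp add: sum_distrib_left sum.distrib sum_subtractf sum_negf algebra_simps)
  have tau: "p - q - (sum yp B - sum ym B) = \<epsilon> * \<kappa>"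
  proof -
    have "sum x A = x i + x k" by (rule two) (use supp in auto)
    moreover have "sum y B = sum yp B - sum ym B" by (simp add: yy(1) sum_subtractf)
    moreover have "sum x A - sum y B = \<epsilon> * \<kappa>" using dep unfolding coupled_weights_def by blast
    ultimately show ?thesis by (simp add: p_def q_def)
  qed
  have sqp: "(\<Sum>j\<in>B. (yp j - p * N i j)\<^sup>2) = (\<Sum>j\<in>B. (yp j)\<^sup>2) - 2 * p * a + p\<^sup>2 * (\<Sum>j\<in>B. (N i j)\<^sup>2)"
    unfolding a_def
    by (simp add: power2_diff power_mult_distrib sum_distrib_left sum.distrib sum_subtractf algebra_simps)
  have sqm: "(\<Sum>j\<in>B. (ym j - q * N k j)\<^sup>2) = (\<Sum>j\<in>B. (ym j)\<^sup>2) - 2 * q * e + q\<^sup>2 * (\<Sum>j\<in>B. (N k j)\<^sup>2)"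
    unfolding e_def
    by (simp add: power2_diff power_mult_distrib sum_distrib_left sum.distrib sum_subtractf algebra_simps)
  \<comment> \<open>The form at the positive part \<open>(p e\<^sub>i, yp)\<close> and at the negative part \<open>(q e\<^sub>k, ym)\<close>, written with
    completed squares.\<close>
  define Qp where "Qp = (\<Sum>j\<in>B. (yp j - p * N i j)\<^sup>2) + p\<^sup>2 * (1 - (\<Sum>j\<in>B. (N i j)\<^sup>2))"
  define Qm where "Qm = (\<Sum>j\<in>B. (ym j - q * N k j)\<^sup>2) + q\<^sup>2 * (1 - (\<Sum>j\<in>B. (N k j)\<^sup>2))"
  have parts: "(\<Sum>j\<in>B. (yp j - p * N i j)\<^sup>2) \<ge> 0" "p\<^sup>2 * (1 - (\<Sum>j\<in>B. (N i j)\<^sup>2)) \<ge> 0"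
     "(\<Sum>j\<in>B. (ym j - q * N k j)\<^sup>2) \<ge> 0" "q\<^sup>2 * (1 - (\<Sum>j\<in>B. (N k j)\<^sup>2)) \<ge> 0"
    using rows[OF ik(1)] rows[OF ik(2)] by (auto intro!: sum_nonneg)
  have "Qp = p * p + p * a - q * c + \<kappa> * sum yp B - 2 * p * a"
    unfolding Qp_def sqp Sp by (simp add: algebra_simps power2_eq_square)
  moreover have "p * p = p * a - p * b - p * \<kappa>"
    using arg_cong[OF xi, of "\<lambda>t. p * t"] by (simp add: algebra_simps)
  ultimately have Qp': "Qp = - p * b - q * c - \<kappa> * (p - sum yp B)"
    by (simp add: algebra_simps)
  have "Qm = q * q - p * b + q * e - \<kappa> * sum ym B - 2 * q * e"
    unfolding Qm_def sqm Sm by (simp add: algebra_simps power2_eq_square)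
  moreover have "q * q = q * e - q * c + q * \<kappa>"
    using arg_cong[OF xk, of "\<lambda>t. - q * t"] by (simp add: algebra_simps)
  ultimately have Qm': "Qm = - p * b - q * c + \<kappa> * (q - sum ym B)"
    by (simp add: algebra_simps)
  have "Qp + Qm = - 2 * (p * b + q * c) - \<kappa> * (p - q - (sum yp B - sum ym B))"
    unfolding Qp' Qm' by (simp add: algebra_simps)
  also have "\<dots> = - 2 * (p * b + q * c) - \<epsilon> * \<kappa>\<^sup>2"
    unfolding tau by (simp add: power2_eq_square)
  also have "\<dots> \<le> 0"
  proof -
    have "p * b \<ge> 0" "q * c \<ge> 0" "\<epsilon> * \<kappa>\<^sup>2 \<ge> 0" using pq nn eps by auto
    then show ?thesis by simp
  qed
  finally have "Qp + Qm \<le> 0" .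
  then have zero: "(\<Sum>j\<in>B. (yp j - p * N i j)\<^sup>2) = 0" "p\<^sup>2 * (1 - (\<Sum>j\<in>B. (N i j)\<^sup>2)) = 0"
     "(\<Sum>j\<in>B. (ym j - q * N k j)\<^sup>2) = 0" "q\<^sup>2 * (1 - (\<Sum>j\<in>B. (N k j)\<^sup>2)) = 0"
    using parts unfolding Qp_def Qm_def by linarith+
  show "(\<Sum>j\<in>B. (N i j)\<^sup>2) = 1" using zero(2) pq by simp
  show "(\<Sum>j\<in>B. (N k j)\<^sup>2) = 1" if "x k < 0" using zero(4) that by (simp add: q_def)
  have ypm: "yp j = p * N i j" "ym j = q * N k j" if "j \<in> B" for j
    using zero(1,3) that fin by (auto simp: sum_nonneg_eq_0_iff)
  show "y j = x i * N i j + x k * N k j" if "j \<in> B" for j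
    using yy(1)[of j] ypm[OF that] by (simp add: p_def q_def)
  show "N i j = 0 \<or> N k j = 0" if "j \<in> B" "x k < 0" for j
    using yy(4)[of j] ypm[OF that(1)] pq that by (auto simp: q_def)
qed

text \<open>Because \<open>t\<^sup>2 < t\<close> strictly between \<open>0\<close> and \<open>1\<close>.\<close>

lemma unit_row_sum:
  fixes n :: "'j \<Rightarrow> real"
  assumes "finite B" "\<And>j. j \<in> B \<Longrightarrow> 0 \<le> n j \<and> n j \<le> 1" "\<And>j. j \<in> B \<Longrightarrow> n j \<noteq> 1"
    and "(\<Sum>j\<in>B. (n j)\<^sup>2) = 1"
  shows "sum n B > 1"
proof -
  obtain j where j: "j \<in> B" "n j \<noteq> 0"
    using assms(4) by (metis (no_types, lifting) power_zero_numeral sum.neutral zero_neq_one)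
  have "(\<Sum>j\<in>B. (n j)\<^sup>2) < sum n B"
  proof (rule sum_strict_mono_ex1[OF assms(1)])
    show "\<forall>j\<in>B. (n j)\<^sup>2 \<le> n j"
      using assms(2) by (auto simp: power2_eq_square mult_left_le)
    have "n j < 1" "n j > 0" using assms(2,3)[OF j(1)] j by auto
    then have "(n j)\<^sup>2 < n j" by (simp add: power2_eq_square)
    then show "\<exists>j\<in>B. (n j)\<^sup>2 < n j" using j by blast
  qed
  then show ?thesis using assms(4) by simp
qed

section \<open>At most two rows without an entry one\<close>

text \<open>
  Let row \<open>i\<close> and column \<open>j\<close> both have norm greater than \<open>1\<close>. Pairing the unit vector at \<open>i\<close> with row \<open>i\<close>
  makes the form negative while the weights on \<open>A\<close> have the smaller sum; pairing column \<open>j\<close> with the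
  unit vector at \<open>j\<close> makes it negative with the larger sum on \<open>A\<close>. The positive combination of the two
  that equalizes the sums contradicts positivity, since the mixed term is nonpositive as well.
\<close>

lemma row_or_column:
  fixes N :: "'i \<Rightarrow> 'j \<Rightarrow> real"
  assumes fin: "finite A" "finite B"
    and N01: "\<And>i j. i \<in> A \<Longrightarrow> j \<in> B \<Longrightarrow> 0 \<le> N i j \<and> N i j \<le> 1"
    and psd: "\<And>x y. sum x A = sum y B \<Longrightarrow>
       2 * (\<Sum>i\<in>A. \<Sum>j\<in>B. x i * N i j * y j) \<le> (\<Sum>i\<in>A. (x i)\<^sup>2) + (\<Sum>j\<in>B. (y j)\<^sup>2)"
  shows "(\<forall>i\<in>A. (\<Sum>j\<in>B. (N i j)\<^sup>2) \<le> 1) \<or> (\<forall>j\<in>B. (\<Sum>i\<in>A. (N i j)\<^sup>2) \<le> 1)"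
proof (rule ccontr)
  assume "\<not> ?thesis"
  then obtain i j where i: "i \<in> A" "(\<Sum>m\<in>B. (N i m)\<^sup>2) > 1" and j: "j \<in> B" "(\<Sum>l\<in>A. (N l j)\<^sup>2) > 1"
    by (auto simp: not_le)
  define \<rho> where "\<rho> = (\<Sum>m\<in>B. (N i m)\<^sup>2)"
  define c where "c = (\<Sum>l\<in>A. (N l j)\<^sup>2)"
  define R where "R = (\<Sum>m\<in>B. N i m)"
  define C where "C = (\<Sum>l\<in>A. N l j)"
  define \<nu> where "\<nu> = N i j"
  define T where "T = (\<Sum>l\<in>A. \<Sum>m\<in>B. N l j * N l m * N i m)"
  have sqle: "t\<^sup>2 \<le> t" if "0 \<le> t" "t \<le> 1" for t :: real
    using that by (simp add: power2_eq_square mult_left_le)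
  have "\<rho> \<le> R" unfolding \<rho>_def R_def using N01 i(1) by (intro sum_mono sqle) auto
  moreover have "c \<le> C" unfolding c_def C_def using N01 j(1) by (intro sum_mono sqle) auto
  moreover have rc: "\<rho> > 1" "c > 1" using i j by (auto simp: \<rho>_def c_def)
  ultimately have RC: "R > 1" "C > 1" by auto
  \<comment> \<open>The two pairs have sum differences \<open>1 - R\<close> and \<open>C - 1\<close>, which these coefficients cancel.\<close>
  define s where "s = C - 1"
  define t where "t = R - 1"
  have st: "s > 0" "t > 0" using RC by (auto simp: s_def t_def)
  define x where "x l = s * (if l = i then 1 else 0) + t * N l j" for l
  define y where "y m = s * N i m + t * (if m = j then 1 else 0)" for m
  have "sum x A = s + t * C"
    unfolding x_def C_def using fin i by (simp add: sum.distrib sum_distrib_left[symmetric])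
  moreover have "sum y B = s * R + t"
    unfolding y_def R_def using fin j by (simp add: sum.distrib sum_distrib_left[symmetric])
  ultimately have "sum x A = sum y B" by (simp add: s_def t_def algebra_simps)
  note P = psd[OF this]
  have "(x l)\<^sup>2 = (if l = i then s\<^sup>2 + 2 * s * t * N l j else 0) + t\<^sup>2 * (N l j)\<^sup>2" for l
    by (simp add: x_def power2_eq_square algebra_simps)
  then have X: "(\<Sum>l\<in>A. (x l)\<^sup>2) = s\<^sup>2 + 2 * s * t * \<nu> + t\<^sup>2 * c"
    using fin i by (simp add: sum.distrib sum_distrib_left[symmetric] c_def \<nu>_def)
  have "(y m)\<^sup>2 = (if m = j then t\<^sup>2 + 2 * s * t * N i m else 0) + s\<^sup>2 * (N i m)\<^sup>2" for m
    by (simp add: y_def power2_eq_square algebra_simps)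
  then have Y: "(\<Sum>m\<in>B. (y m)\<^sup>2) = t\<^sup>2 + 2 * s * t * \<nu> + s\<^sup>2 * \<rho>"
    using fin j by (simp add: sum.distrib sum_distrib_left[symmetric] \<rho>_def \<nu>_def)
  have inner: "(\<Sum>m\<in>B. N l m * y m) = s * (\<Sum>m\<in>B. N l m * N i m) + t * N l j" for l
  proof -
    have "N l m * y m = s * (N l m * N i m) + (if m = j then t * N l m else 0)" for m
      by (simp add: y_def algebra_simps)
    then show ?thesis using fin j by (simp add: sum.distrib sum_distrib_left)
  qed
  have "(\<Sum>l\<in>A. \<Sum>m\<in>B. x l * N l m * y m) = (\<Sum>l\<in>A. x l * (\<Sum>m\<in>B. N l m * y m))"
    by (simp add: sum_distrib_left mult.assoc)
  also have "\<dots> = (\<Sum>l\<in>A. (if l = i then s * (s * (\<Sum>m\<in>B. N l m * N i m) + t * N l j) else 0)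
       + (t * s * (\<Sum>m\<in>B. N l j * N l m * N i m) + t\<^sup>2 * (N l j)\<^sup>2))"
    unfolding inner x_def
    by (intro sum.cong refl) (simp add: algebra_simps power2_eq_square sum_distrib_left)
  also have "\<dots> = s * (s * \<rho> + t * \<nu>) + (t * s * T + t\<^sup>2 * c)"
    using fin i unfolding T_def c_def \<rho>_def \<nu>_def
    by (simp add: sum.distrib sum_distrib_left[symmetric] power2_eq_square)
  finally have XY: "(\<Sum>l\<in>A. \<Sum>m\<in>B. x l * N l m * y m) = s * (s * \<rho> + t * \<nu>) + (t * s * T + t\<^sup>2 * c)" .
  \<comment> \<open>The mixed term \<open>\<nu> - T\<close> is nonpositive: the part of \<open>T\<close> with \<open>l = i\<close> is \<open>\<nu>\<close> times the squared norm
    of row \<open>i\<close>.\<close>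
  have nuT: "\<nu> \<le> T"
  proof -
    have "\<nu> * \<rho> = (\<Sum>m\<in>B. N i j * N i m * N i m)"
      by (simp add: \<nu>_def \<rho>_def sum_distrib_left power2_eq_square mult.assoc)
    also have "\<dots> \<le> T"
      unfolding T_def
      by (rule member_le_sum[of i A "\<lambda>l. \<Sum>m\<in>B. N l j * N l m * N i m"])
         (use fin i j N01 in \<open>auto intro!: sum_nonneg mult_nonneg_nonneg\<close>)
    finally have "\<nu> * \<rho> \<le> T" .
    moreover have "\<nu> \<le> \<nu> * \<rho>" using rc N01[OF i(1) j(1)] by (simp add: \<nu>_def mult_left_le mult_le_cancel_left1)
    ultimately show ?thesis by linarith
  qed
  have "s\<^sup>2 * (1 - \<rho>) + t\<^sup>2 * (1 - c) + 2 * (s * t) * (\<nu> - T) \<ge> 0"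
    using P unfolding X Y XY by (simp add: algebra_simps power2_eq_square)
  moreover have "s\<^sup>2 * (1 - \<rho>) < 0" "t\<^sup>2 * (1 - c) < 0" "2 * (s * t) * (\<nu> - T) \<le> 0"
    using st rc nuT by (auto simp: mult_less_0_iff mult_le_0_iff)
  ultimately show False by linarith
qed


text \<open>
  The hypothesis \<open>dep\<close> yields for each pair of unmatched rows a dependency that is nonzero at both. Two
  of these that share a row can be combined to eliminate it, which turns equal signs into opposite
  ones and makes the sign lemma applicable. If it forces norm \<open>1\<close> on all unmatched rows, the sum of
  all entries is too large; otherwise the disjoint supports of the remaining rows do not fit into
  \<open>B\<close>.
\<close>

lemma few_unmatched_rows:
  fixes N :: "'i \<Rightarrow> 'j \<Rightarrow> real"
  assumes fin: "finite A" "finite B" and card: "card A = card B"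
    and N01: "\<And>i j. i \<in> A \<Longrightarrow> j \<in> B \<Longrightarrow> 0 \<le> N i j \<and> N i j \<le> 1"
    and psd: "\<And>x y. sum x A = sum y B \<Longrightarrow>
       2 * (\<Sum>i\<in>A. \<Sum>j\<in>B. x i * N i j * y j) \<le> (\<Sum>i\<in>A. (x i)\<^sup>2) + (\<Sum>j\<in>B. (y j)\<^sup>2)"
    and match: "\<And>i k j. i \<in> A \<Longrightarrow> k \<in> A \<Longrightarrow> i \<noteq> k \<Longrightarrow> j \<in> B \<Longrightarrow> N i j = 1 \<Longrightarrow> N k j = 0"
    and rows: "\<And>i. i \<in> A \<Longrightarrow> (\<Sum>j\<in>B. (N i j)\<^sup>2) \<le> 1"
    and eps: "\<epsilon> \<ge> 0"
    and U: "U = {i\<in>A. \<forall>j\<in>B. N i j \<noteq> 1}"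
    and dep: "\<And>i k. i \<in> U \<Longrightarrow> k \<in> U \<Longrightarrow> i \<noteq> k \<Longrightarrow> \<exists>x y \<kappa>. coupled_weights A B N \<epsilon> x y \<kappa> \<and>
        (\<forall>l\<in>A - {i,k}. x l = 0) \<and> ((\<exists>l\<in>A. x l \<noteq> 0) \<or> (\<exists>j\<in>B. y j \<noteq> 0))"
  shows "card U \<le> 2"
proof (rule ccontr)
  assume "\<not> card U \<le> 2"
  then have U3: "card U \<ge> 3" by simp
  have UA: "U \<subseteq> A" and finU: "finite U" using U fin by auto
  have "U \<noteq> {}" using U3 by auto
  then have Ane: "A \<noteq> {}" using UA by auto
  \<comment> \<open>A dependency on a single row would make that row a unit vector with entry sum \<open>1\<close>, so it would
    contain an entry \<open>1\<close>.\<close>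
  have nz: "x i \<noteq> 0" if d: "coupled_weights A B N \<epsilon> x y \<kappa>" and s0: "\<And>l. l \<in> A - {i,k} \<Longrightarrow> x l = 0"
    and ne: "(\<exists>l\<in>A. x l \<noteq> 0) \<or> (\<exists>j\<in>B. y j \<noteq> 0)" and ik: "i \<in> U" "k \<in> U" "i \<noteq> k" for x y \<kappa> i k
  proof
    assume xi: "x i = 0"
    have yx: "y j = (\<Sum>l\<in>A. N l j * x l) + \<kappa>" if "j \<in> B" for j using d that unfolding coupled_weights_def by blast
    have tau: "sum x A - sum y B = \<epsilon> * \<kappa>" using d unfolding coupled_weights_def by blast
    show False
    proof (cases "x k = 0")
      case True
      then have x0: "x l = 0" if "l \<in> A" for l using s0 xi that by (cases "l \<in> {i,k}") auto
      then have y\<kappa>: "y j = \<kappa>" if "j \<in> B" for j using yx[OF that] by simp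
      then have "- (real (card B) * \<kappa>) = \<epsilon> * \<kappa>" using tau x0 by simp
      then have "\<kappa> * (\<epsilon> + real (card B)) = 0" by (simp add: algebra_simps)
      moreover have "card B > 0" using card Ane fin by (metis card_gt_0_iff)
      ultimately have "\<kappa> = 0" using eps by (simp add: add_nonneg_eq_0_iff)
      then show False using ne x0 y\<kappa> by auto
    next
      case False
      define c where "c = sgn (x k)"
      have c: "c * x k > 0" "c \<noteq> 0" using False by (auto simp: c_def sgn_if)
      have d': "coupled_weights A B N \<epsilon> (\<lambda>i. c * x i) (\<lambda>j. c * y j) (c * \<kappa>)"
        using coupled_weights_combine[OF d d, of c 0] by simp
      note O = unit_rows_if_opposite_signs[OF fin _ _ ik(3)[symmetric] _ rows eps d']
      have kA: "k \<in> A" "i \<in> A" using ik UA by auto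
      have n1: "(\<Sum>j\<in>B. (N k j)\<^sup>2) = 1"
        by (rule O(1)) (use kA N01 s0 xi c in auto)
      have "c * y j = c * x k * N k j + c * x i * N i j" if "j \<in> B" for j
        by (rule O(3)) (use kA N01 s0 xi c that in auto)
      then have yN: "y j = x k * N k j" if "j \<in> B" for j using that c xi by simp
      have "B \<noteq> {}" using card Ane fin by (metis card_eq_0_iff)
      then obtain j where j: "j \<in> B" by auto
      have "(\<Sum>l\<in>A. N l j * x l) = (\<Sum>l\<in>{k}. N l j * x l)"
        by (rule sum.mono_neutral_right) (use fin kA s0 xi in auto)
      then have "\<kappa> = 0" using yx[OF j] yN[OF j] by (simp add: algebra_simps)
      moreover have "sum x A = sum x {k}"
        by (rule sum.mono_neutral_right) (use fin kA s0 xi in auto)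
      ultimately have "x k = x k * sum (N k) B"
        using tau yN by (simp add: sum_distrib_left)
      then have "sum (N k) B = 1" using False by simp
      moreover have "sum (N k) B > 1"
        by (rule unit_row_sum) (use fin N01 kA n1 ik U in auto)
      ultimately show False by simp
    qed
  qed
  have pair: "\<exists>x y \<kappa>. coupled_weights A B N \<epsilon> x y \<kappa> \<and> (\<forall>l\<in>A - {i,k}. x l = 0) \<and> x i > 0 \<and> x k \<noteq> 0"
    if ik: "i \<in> U" "k \<in> U" "i \<noteq> k" for i k
  proof -
    obtain x y \<kappa> where d: "coupled_weights A B N \<epsilon> x y \<kappa>" and s0: "\<forall>l\<in>A - {i,k}. x l = 0"
      and ne: "(\<exists>l\<in>A. x l \<noteq> 0) \<or> (\<exists>j\<in>B. y j \<noteq> 0)"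
      using dep[OF ik] by blast
    have xi: "x i \<noteq> 0" by (rule nz[OF d _ ne ik]) (use s0 in auto)
    have xk: "x k \<noteq> 0" by (rule nz[OF d _ ne ik(2,1) ik(3)[symmetric]]) (use s0 in auto)
    define c where "c = sgn (x i)"
    have c: "c * x i > 0" "c \<noteq> 0" using xi by (auto simp: c_def sgn_if)
    have "coupled_weights A B N \<epsilon> (\<lambda>i. c * x i) (\<lambda>j. c * y j) (c * \<kappa>)"
      using coupled_weights_combine[OF d d, of c 0] by simp
    then show ?thesis using s0 xk c by (intro exI[of _ "\<lambda>i. c * x i"] exI[of _ "\<lambda>i. c * y i"] exI[of _ "c * \<kappa>"]) auto
  qed
  show False
  proof (cases "\<forall>i\<in>U. (\<Sum>j\<in>B. (N i j)\<^sup>2) = 1")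
    case True
    have ge: "sum (N i) B \<ge> 1" if "i \<in> A" for i
    proof (cases "i \<in> U")
      case iU: True
      have "sum (N i) B > 1"
        by (rule unit_row_sum) (use fin N01 that True iU U in auto)
      then show ?thesis by simp
    next
      case False
      then obtain j where j: "j \<in> B" "N i j = 1" using \<open>i \<in> A\<close> U by auto
      have "N i j \<le> sum (N i) B"
        by (rule member_le_sum) (use fin N01 that j in auto)
      then show ?thesis using j by simp
    qed
    obtain r where r: "r \<in> U" using \<open>U \<noteq> {}\<close> by auto
    have "(\<Sum>i\<in>A. 1) < (\<Sum>i\<in>A. sum (N i) B)"
    proof (rule sum_strict_mono_ex1[OF fin(1)])
      show "\<forall>i\<in>A. 1 \<le> sum (N i) B" using ge by auto
      have "sum (N r) B > 1"
        by (rule unit_row_sum) (use fin N01 True r U in auto)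
      then show "\<exists>i\<in>A. 1 < sum (N i) B" using r UA by auto
    qed
    moreover have "2 * (\<Sum>i\<in>A. sum (N i) B) \<le> real (card A) + real (card B)"
      using psd[of "\<lambda>_. 1" "\<lambda>_. 1"] card by simp
    ultimately show False using card by simp
  next
    case False
    then obtain r where r: "r \<in> U" "(\<Sum>j\<in>B. (N r j)\<^sup>2) \<noteq> 1" by auto
    have opp: "(\<Sum>j\<in>B. (N k j)\<^sup>2) = 1 \<and> (\<forall>j\<in>B. N k j = 0 \<or> N l j = 0)"
      if kl: "k \<in> U" "l \<in> U" "k \<noteq> l" "k \<noteq> r" "l \<noteq> r" for k l
    proof -
      have A: "k \<in> A" "l \<in> A" "r \<in> A" using kl r UA by auto
      obtain x y \<kappa> where d: "coupled_weights A B N \<epsilon> x y \<kappa>" and s0: "\<forall>m\<in>A - {r,k}. x m = 0" and xr: "x r > 0" "x k \<noteq> 0"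
        using pair[OF r(1) kl(1)] kl by blast
      obtain x' y' \<kappa>' where d': "coupled_weights A B N \<epsilon> x' y' \<kappa>'" and s0': "\<forall>m\<in>A - {r,l}. x' m = 0" and xr': "x' r > 0" "x' l \<noteq> 0"
        using pair[OF r(1) kl(2)] kl by blast
      have xk: "x k > 0"
      proof (rule ccontr)
        assume "\<not> x k > 0"
        then have "(\<Sum>j\<in>B. (N r j)\<^sup>2) = 1"
          by (intro unit_rows_if_opposite_signs(1)[OF fin A(3) A(1) kl(4)[symmetric] _ rows eps d]) (use s0 xr N01 in auto)
        then show False using r by simp
      qed
      have xl: "x' l > 0"
      proof (rule ccontr)
        assume "\<not> x' l > 0"
        then have "(\<Sum>j\<in>B. (N r j)\<^sup>2) = 1"
          by (intro unit_rows_if_opposite_signs(1)[OF fin A(3) A(2) kl(5)[symmetric] _ rows eps d']) (use s0' xr' N01 in auto)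
        then show False using r by simp
      qed
      \<comment> \<open>Both dependencies have equal signs, since \<open>r\<close> has norm less than \<open>1\<close>. Eliminating \<open>r\<close> leaves
        opposite signs at \<open>k\<close> and \<open>l\<close>.\<close>
      define z where "z i = x' r * x i + (- x r) * x' i" for i
      define u where "u j = x' r * y j + (- x r) * y' j" for j
      have dz: "coupled_weights A B N \<epsilon> z u (x' r * \<kappa> + (- x r) * \<kappa>')"
        unfolding z_def u_def by (rule coupled_weights_combine[OF d d'])
      have z0: "z m = 0" if "m \<in> A - {k,l}" for m
        using that s0 s0' by (cases "m = r") (auto simp: z_def)
      have zk: "z k > 0" using A kl s0' xk xr' by (simp add: z_def)
      have zl: "z l < 0" using A kl s0 xl xr by (simp add: z_def)
      have "(\<Sum>j\<in>B. (N k j)\<^sup>2) = 1"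
        by (rule unit_rows_if_opposite_signs(1)[OF fin A(1,2) kl(3) _ rows eps dz]) (use z0 zk zl N01 in auto)
      moreover have "N k j = 0 \<or> N l j = 0" if "j \<in> B" for j
        by (rule unit_rows_if_opposite_signs(4)[OF fin A(1,2) kl(3) _ rows eps dz]) (use z0 zk zl N01 that in auto)
      ultimately show ?thesis by blast
    qed
    have n1: "(\<Sum>j\<in>B. (N k j)\<^sup>2) = 1" if k: "k \<in> U" "k \<noteq> r" for k
    proof -
      have "card (U - {r,k}) \<ge> 1" using U3 finU r k by (simp add: card_Diff_subset)
      then obtain l where "l \<in> U - {r,k}" by (metis One_nat_def card.empty ex_in_conv not_one_le_zero)
      then show ?thesis using opp[of k l] k by auto
    qed
    define S where "S k = {j\<in>B. N k j \<noteq> 0}" for k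
    have matched: "\<exists>j\<in>B. S k = {j} \<and> N k j = 1" if k: "k \<in> A" "k \<notin> U" for k
    proof -
      obtain j where j: "j \<in> B" "N k j = 1" using k U by auto
      have "(\<Sum>m\<in>B. (N k m)\<^sup>2) = (N k j)\<^sup>2 + (\<Sum>m\<in>B-{j}. (N k m)\<^sup>2)"
        using fin j by (simp add: sum.remove)
      then have "(\<Sum>m\<in>B-{j}. (N k m)\<^sup>2) \<le> 0" using rows[OF k(1)] j by simp
      then have "(\<Sum>m\<in>B-{j}. (N k m)\<^sup>2) = 0" by (simp add: sum_nonneg eq_iff)
      then have "\<forall>m\<in>B-{j}. N k m = 0" using fin by (simp add: sum_nonneg_eq_0_iff)
      then show ?thesis using j by (auto simp: S_def)
    qed
    have disj: "S k \<inter> S l = {}" if kl: "k \<in> A - {r}" "l \<in> A - {r}" "k \<noteq> l" for k l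
    proof (cases "k \<in> U \<and> l \<in> U")
      case True
      then show ?thesis using opp[of k l] kl by (auto simp: S_def)
    next
      case False
      have aux: "S k \<inter> S l = {}" if kl: "k \<in> A" "l \<in> A" "k \<noteq> l" "k \<notin> U" for k l
      proof -
        obtain j where "j \<in> B" "S k = {j}" "N k j = 1" using matched kl by blast
        then show ?thesis using match[of k l j] kl by (auto simp: S_def)
      qed
      show ?thesis using aux[of k l] aux[of l k] False kl by auto
    qed
    have finS: "finite (S k)" for k using fin by (simp add: S_def)
    have big: "card (S k) \<ge> (if k \<in> U then 2 else 1)" if k: "k \<in> A - {r}" for k
    proof (cases "k \<in> U")
      case False
      then show ?thesis using matched[of k] k by auto
    next
      case True
      have sq: "(\<Sum>j\<in>S k. (N k j)\<^sup>2) = 1"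
        using n1[OF True] k fin
        by (subst sum.mono_neutral_left[of B "S k"]) (auto simp: S_def)
      have "\<not> card (S k) \<le> 1"
      proof
        assume "card (S k) \<le> 1"
        then consider "S k = {}" | j where "S k = {j}"
          using finS[of k] by (metis card_0_eq card_1_singletonE le_less_Suc_eq less_one linorder_not_le One_nat_def nless_le)
        then show False
        proof cases
          case 1
          then show False using sq by simp
        next
          case (2 j)
          then have "(N k j)\<^sup>2 = 1" "j \<in> B" using sq by (auto simp: S_def)
          then have "N k j = 1" using N01[of k j] k by (auto simp: power2_eq_1_iff)
          then show False using True U \<open>j \<in> B\<close> by auto
        qed
      qed
      then show ?thesis using True by simp
    qed
    \<comment> \<open>The supports other than that of \<open>r\<close> occupy at least \<open>(card A - 1) + (card U - 1)\<close> columns.\<close>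
    have "(\<Sum>k\<in>A-{r}. if k \<in> U then 2 else 1) \<le> (\<Sum>k\<in>A-{r}. card (S k))"
      by (rule sum_mono) (use big in auto)
    also have "\<dots> = card (\<Union>k\<in>A-{r}. S k)"
      by (rule card_UN_disjoint[symmetric]) (use fin finS disj in auto)
    also have "\<dots> \<le> card B"
      by (rule card_mono) (use fin in \<open>auto simp: S_def\<close>)
    finally have le: "(\<Sum>k\<in>A-{r}. if k \<in> U then 2 else 1::nat) \<le> card A" using card by simp
    have "(\<Sum>k\<in>A-{r}. if k \<in> U then 2 else 1::nat) = (\<Sum>k\<in>A-{r}. 1 + (if k \<in> U then 1 else 0))"
      by (rule sum.cong) auto
    also have "\<dots> = card (A - {r}) + card ((A - {r}) \<inter> U)"
      unfolding sum.distrib using fin by (simp add: sum.If_cases)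
    also have "(A - {r}) \<inter> U = U - {r}" using UA by auto
    also have "card (A - {r}) = card A - 1" using r UA by (auto simp: card_Diff_subset)
    also have "card (U - {r}) = card U - 1" using r finU by simp
    finally show False using le U3 card_mono[OF fin(1) UA] by linarith
  qed
qed


section \<open>Weighted vertices of unit simplices\<close>

text \<open>Polarization, \<open>2 * (p \<bullet> q) = (norm p)\<^sup>2 + (norm q)\<^sup>2 - (norm (p - q))\<^sup>2\<close>, summed over all pairs.\<close>

lemma inner_weighted_sums:
  fixes x y :: "'a::real_inner \<Rightarrow> real"
  shows "2 * ((\<Sum>p\<in>D. x p *\<^sub>R p) \<bullet> (\<Sum>q\<in>E. y q *\<^sub>R q)) =
    sum y E * (\<Sum>p\<in>D. x p * (norm p)\<^sup>2) + sum x D * (\<Sum>q\<in>E. y q * (norm q)\<^sup>2)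
    - sum x D * sum y E + (\<Sum>p\<in>D. \<Sum>q\<in>E. x p * (1 - (norm (p - q))\<^sup>2) * y q)"
proof -
  have e: "2 * ((x p *\<^sub>R p) \<bullet> (y q *\<^sub>R q)) = y q * (x p * (norm p)\<^sup>2) + x p * (y q * (norm q)\<^sup>2)
      - x p * y q + x p * (1 - (norm (p - q))\<^sup>2) * y q" for p q
  proof -
    have "(norm (p - q))\<^sup>2 = (norm p)\<^sup>2 + (norm q)\<^sup>2 - 2 * (p \<bullet> q)"
      by (simp add: power2_norm_eq_inner inner_diff inner_commute)
    then show ?thesis by (simp only:) (simp add: algebra_simps)
  qed
  have "2 * ((\<Sum>p\<in>D. x p *\<^sub>R p) \<bullet> (\<Sum>q\<in>E. y q *\<^sub>R q)) =
     (\<Sum>p\<in>D. \<Sum>q\<in>E. 2 * ((x p *\<^sub>R p) \<bullet> (y q *\<^sub>R q)))"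
    by (simp add: inner_sum_left inner_sum_right sum_distrib_left sum.swap[of _ E D])
  also have "\<dots> = (\<Sum>p\<in>D. \<Sum>q\<in>E. y q * (x p * (norm p)\<^sup>2)) + (\<Sum>p\<in>D. \<Sum>q\<in>E. x p * (y q * (norm q)\<^sup>2))
      - (\<Sum>p\<in>D. \<Sum>q\<in>E. x p * y q) + (\<Sum>p\<in>D. \<Sum>q\<in>E. x p * (1 - (norm (p - q))\<^sup>2) * y q)"
    unfolding e by (simp only: sum.distrib sum_subtractf)
  also have "(\<Sum>p\<in>D. \<Sum>q\<in>E. y q * (x p * (norm p)\<^sup>2)) = sum y E * (\<Sum>p\<in>D. x p * (norm p)\<^sup>2)"
    by (simp add: sum_product sum.swap[of _ E])
  also have "(\<Sum>p\<in>D. \<Sum>q\<in>E. x p * (y q * (norm q)\<^sup>2)) = sum x D * (\<Sum>q\<in>E. y q * (norm q)\<^sup>2)"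
    by (simp add: sum_product)
  also have "(\<Sum>p\<in>D. \<Sum>q\<in>E. x p * y q) = sum x D * sum y E"
    by (simp add: sum_product)
  finally show ?thesis .
qed

lemma simplex_sq_dist:
  assumes "unit_regular_simplex d X D" "p \<in> D" "q \<in> D"
  shows "1 - (norm (p - q))\<^sup>2 = (if p = q then 1 else 0)"
  using assms by (auto simp: unit_regular_simplex_def)

text \<open>
  The difference of the two sides is \<open>2 * (a - b) \<bullet> (a - b)\<close> for the weighted vertex sums \<open>a\<close> and \<open>b\<close>.
  Expanding by polarization, the terms with squared norms of vertices cancel because the weights
  have equal sums, and within one simplex the matrix \<open>1 - (norm (p - q))\<^sup>2\<close> is the identity.
\<close>

lemma simplex_gap:
  assumes D: "unit_regular_simplex d X D" and E: "unit_regular_simplex d X E"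
    and s: "sum x D = sum y E"
  shows "2 * (\<Sum>p\<in>D. \<Sum>q\<in>E. x p * (1 - (norm (p - q))\<^sup>2) * y q)
     \<le> (\<Sum>p\<in>D. (x p)\<^sup>2) + (\<Sum>q\<in>E. (y q)\<^sup>2)"
proof -
  define a where "a = (\<Sum>p\<in>D. x p *\<^sub>R p)"
  define b where "b = (\<Sum>q\<in>E. y q *\<^sub>R q)"
  have self: "(\<Sum>p\<in>F. \<Sum>q\<in>F. z p * (1 - (norm (p - q))\<^sup>2) * z q) = (\<Sum>p\<in>F. (z p)\<^sup>2)"
    if F: "unit_regular_simplex d X F" for F z
  proof (rule sum.cong[OF refl])
    fix p assume p: "p \<in> F"
    have "(\<Sum>q\<in>F. z p * (1 - (norm (p - q))\<^sup>2) * z q) = (\<Sum>q\<in>F. if p = q then z p * z q else 0)"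
      by (rule sum.cong) (use simplex_sq_dist[OF F p] in auto)
    also have "\<dots> = (z p)\<^sup>2"
      using F p by (simp add: unit_regular_simplex_def power2_eq_square)
    finally show "(\<Sum>q\<in>F. z p * (1 - (norm (p - q))\<^sup>2) * z q) = (z p)\<^sup>2" .
  qed
  have "0 \<le> (a - b) \<bullet> (a - b)" by simp
  also have "\<dots> = a \<bullet> a + b \<bullet> b - 2 * (a \<bullet> b)"
    by (simp add: inner_diff inner_commute)
  finally have "0 \<le> 2 * (a \<bullet> a) + 2 * (b \<bullet> b) - 2 * (2 * (a \<bullet> b))" by simp
  then show ?thesis
    unfolding a_def b_def inner_weighted_sums self[OF D] self[OF E] s
    by (simp add: algebra_simps)
qed

section \<open>Dependencies among points of the space or the sphere\<close>

text \<open>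
  In the Euclidean space an affine dependency of \<open>d + 2\<close> points does it, with \<open>\<epsilon> = 0\<close>. On the sphere a
  linear dependency of the \<open>d + 2\<close> vectors from the center in dimension \<open>d + 1\<close> does it: the value is
  \<open>K = 2 * r\<^sup>2 * sum u S\<close>, so \<open>\<epsilon> = 1 / (2 * r\<^sup>2 - 1)\<close>, which is positive exactly for
  \<open>r > 1 / sqrt 2\<close>.
\<close>

lemma equidistance_weights:
  fixes X :: "'a::euclidean_space set"
  assumes X: "(DIM('a) = d \<and> X = UNIV) \<or>
         (DIM('a) = d + 1 \<and> (\<exists>c r. r > 1 / sqrt 2 \<and> X = sphere c r))"
  shows "\<exists>\<epsilon>\<ge>0. \<forall>S. finite S \<longrightarrow> S \<subseteq> X \<longrightarrow> card S = d + 2 \<longrightarrow>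
     (\<exists>u K. (\<exists>q\<in>S. u q \<noteq> 0) \<and> (\<forall>p\<in>X. (\<Sum>q\<in>S. u q * (norm (q - p))\<^sup>2) = K) \<and>
        sum u S = \<epsilon> * (K - sum u S))"
  using X
proof
  assume E: "DIM('a) = d \<and> X = UNIV"
  show ?thesis
  proof (intro exI[of _ 0] conjI allI impI)
    fix S :: "'a set" assume S: "finite S" "S \<subseteq> X" "card S = d + 2"
    have "affine_dependent S"
      using S E by (intro affine_dependent_biggerset) auto
    then obtain u where u: "sum u S = 0" "\<exists>q\<in>S. u q \<noteq> 0" "(\<Sum>q\<in>S. u q *\<^sub>R q) = 0"
      using affine_dependent_explicit_finite[OF S(1)] by auto
    have "(\<Sum>q\<in>S. u q * (norm (q - p))\<^sup>2) = (\<Sum>q\<in>S. u q * (norm q)\<^sup>2)" for p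
    proof -
      have "(\<Sum>q\<in>S. u q * (norm (q - p))\<^sup>2) =
         (\<Sum>q\<in>S. u q * (norm q)\<^sup>2 + u q * (norm p)\<^sup>2 - 2 * ((u q *\<^sub>R q) \<bullet> p))"
        by (rule sum.cong) (auto simp: power2_norm_eq_inner inner_diff inner_commute algebra_simps)
      also have "\<dots> = (\<Sum>q\<in>S. u q * (norm q)\<^sup>2) + sum u S * (norm p)\<^sup>2 - 2 * ((\<Sum>q\<in>S. u q *\<^sub>R q) \<bullet> p)"
        by (simp add: sum.distrib sum_subtractf sum_distrib_left sum_distrib_right inner_sum_left)
      finally show ?thesis using u by simp
    qed
    then show "\<exists>u K. (\<exists>q\<in>S. u q \<noteq> 0) \<and> (\<forall>p\<in>X. (\<Sum>q\<in>S. u q * (norm (q - p))\<^sup>2) = K) \<and>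
        sum u S = 0 * (K - sum u S)"
      using u by (intro exI[of _ u]) auto
  qed simp
next
  assume "DIM('a) = d + 1 \<and> (\<exists>c r. r > 1 / sqrt 2 \<and> X = sphere c r)"
  then obtain c :: 'a and r where dim: "DIM('a) = d + 1" and r: "r > 1 / sqrt 2" and Xs: "X = sphere c r"
    by auto
  have "(1 / sqrt 2)\<^sup>2 < r\<^sup>2" using r by (intro power_strict_mono) auto
  then have r2: "2 * r\<^sup>2 - 1 > 0" by (simp add: power_divide)
  show ?thesis
  proof (intro exI[of _ "1 / (2 * r\<^sup>2 - 1)"] conjI allI impI)
    show "0 \<le> 1 / (2 * r\<^sup>2 - 1)" using r2 by simp
    fix S :: "'a set" assume S: "finite S" "S \<subseteq> X" "card S = d + 2"
    have inj: "inj_on (\<lambda>q. q - c) S" by (auto simp: inj_on_def)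
    have "dependent ((\<lambda>q. q - c) ` S)"
      using S dim by (intro dependent_biggerset) (auto simp: card_image[OF inj])
    then obtain f where f: "\<exists>v\<in>(\<lambda>q. q - c) ` S. f v \<noteq> 0" "(\<Sum>v\<in>(\<lambda>q. q - c) ` S. f v *\<^sub>R v) = 0"
      using dependent_finite[of "(\<lambda>q. q - c) ` S"] S by auto
    define u where "u q = f (q - c)" for q
    have u: "\<exists>q\<in>S. u q \<noteq> 0" "(\<Sum>q\<in>S. u q *\<^sub>R (q - c)) = 0"
      using f by (auto simp: u_def sum.reindex[OF inj])
    have "(\<Sum>q\<in>S. u q * (norm (q - p))\<^sup>2) = 2 * r\<^sup>2 * sum u S" if p: "p \<in> X" for p
    proof -
      have n: "(norm (q - p))\<^sup>2 = 2 * r\<^sup>2 - 2 * ((q - c) \<bullet> (p - c))" if q: "q \<in> S" for q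
      proof -
        have "(norm (q - c))\<^sup>2 = r\<^sup>2" "(norm (p - c))\<^sup>2 = r\<^sup>2"
          using q p S Xs by (auto simp: dist_norm norm_minus_commute)
        moreover have "(norm (q - p))\<^sup>2 = (norm (q - c))\<^sup>2 + (norm (p - c))\<^sup>2 - 2 * ((q - c) \<bullet> (p - c))"
          by (simp add: power2_norm_eq_inner inner_diff inner_commute)
        ultimately show ?thesis by simp
      qed
      have "(\<Sum>q\<in>S. u q * (norm (q - p))\<^sup>2) = (\<Sum>q\<in>S. 2 * r\<^sup>2 * u q - 2 * ((u q *\<^sub>R (q - c)) \<bullet> (p - c)))"
        by (rule sum.cong) (auto simp: n algebra_simps)
      also have "\<dots> = 2 * r\<^sup>2 * sum u S - 2 * ((\<Sum>q\<in>S. u q *\<^sub>R (q - c)) \<bullet> (p - c))"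
        by (simp add: sum_subtractf sum_distrib_left inner_sum_left)
      finally show ?thesis using u by simp
    qed
    moreover have "sum u S = 1 / (2 * r\<^sup>2 - 1) * (2 * r\<^sup>2 * sum u S - sum u S)"
      using r2 by (simp add: field_simps)
    ultimately show "\<exists>u K. (\<exists>q\<in>S. u q \<noteq> 0) \<and> (\<forall>p\<in>X. (\<Sum>q\<in>S. u q * (norm (q - p))\<^sup>2) = K) \<and>
        sum u S = 1 / (2 * r\<^sup>2 - 1) * (K - sum u S)"
      using u by blast
  qed
qed

section \<open>Sharing all but two vertices\<close>

text \<open>
  For two vertices \<open>i\<close>, \<open>k\<close> of \<open>D\<close> outside \<open>E\<close>, the set \<open>{i, k} \<union> E\<close> has \<open>d + 2\<close> points. Evaluating
  its dependency at the vertices of \<open>D\<close> gives the equations for \<open>x\<close>, at those of \<open>E\<close> the equations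
  for \<open>y\<close>.
\<close>

lemma few_private_vertices:
  fixes D E X :: "'a::euclidean_space set"
  assumes D: "unit_regular_simplex d X D" and E: "unit_regular_simplex d X E"
    and eps: "\<epsilon> \<ge> 0"
    and wt: "\<And>S. finite S \<Longrightarrow> S \<subseteq> X \<Longrightarrow> card S = d + 2 \<Longrightarrow>
     \<exists>u K. (\<exists>q\<in>S. u q \<noteq> 0) \<and> (\<forall>p\<in>X. (\<Sum>q\<in>S. u q * (norm (q - p))\<^sup>2) = K) \<and>
        sum u S = \<epsilon> * (K - sum u S)"
    and close: "\<And>p q. p \<in> D \<Longrightarrow> q \<in> E \<Longrightarrow> norm (p - q) \<le> 1"
    and rows: "\<And>p. p \<in> D \<Longrightarrow> (\<Sum>q\<in>E. (1 - (norm (p - q))\<^sup>2)\<^sup>2) \<le> 1"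
  shows "card (D - E) \<le> 2"
proof -
  define N where "N p q = 1 - (norm (p - q))\<^sup>2" for p q :: 'a
  have fin: "finite D" "finite E" and cards: "card D = d" "card E = d" and sub: "D \<subseteq> X" "E \<subseteq> X"
    using D E by (auto simp: unit_regular_simplex_def)
  have one: "N p q = 1 \<longleftrightarrow> p = q" for p q by (simp add: N_def)
  show ?thesis
  proof (rule few_unmatched_rows[of D E N \<epsilon>])
    show "0 \<le> N i j \<and> N i j \<le> 1" if "i \<in> D" "j \<in> E" for i j
      using close[OF that] by (auto simp: N_def power_le_one)
    show "2 * (\<Sum>i\<in>D. \<Sum>j\<in>E. x i * N i j * y j) \<le> (\<Sum>i\<in>D. (x i)\<^sup>2) + (\<Sum>j\<in>E. (y j)\<^sup>2)"
      if "sum x D = sum y E" for x y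
      unfolding N_def by (rule simplex_gap[OF D E that])
    show "N k j = 0" if "i \<in> D" "k \<in> D" "i \<noteq> k" "j \<in> E" "N i j = 1" for i k j
      using simplex_sq_dist[OF D that(2,1)] that one by (auto simp: N_def)
    show "(\<Sum>j\<in>E. (N i j)\<^sup>2) \<le> 1" if "i \<in> D" for i using rows[OF that] by (simp add: N_def)
    show "D - E = {i \<in> D. \<forall>j\<in>E. N i j \<noteq> 1}" using one by auto
    fix i k assume ik: "i \<in> D - E" "k \<in> D - E" "i \<noteq> k"
    define S where "S = {i,k} \<union> E"
    have S: "finite S" "S \<subseteq> X" "card S = d + 2"
      using ik fin sub cards by (auto simp: S_def)
    obtain u K where u: "\<exists>q\<in>S. u q \<noteq> 0" "\<And>p. p \<in> X \<Longrightarrow> (\<Sum>q\<in>S. u q * (norm (q - p))\<^sup>2) = K"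
      "sum u S = \<epsilon> * (K - sum u S)"
      using wt[OF S] by blast
    define x where "x l = (if l \<in> {i,k} then u l else 0)" for l
    \<comment> \<open>The sign moves the points of \<open>E\<close> to the other side of the dependency.\<close>
    define y where "y j = - u j" for j
    have split: "(\<Sum>q\<in>S. u q * g q) = (\<Sum>q\<in>D. x q * g q) - (\<Sum>q\<in>E. y q * g q)" for g :: "'a \<Rightarrow> real"
    proof -
      have "(\<Sum>q\<in>S. u q * g q) = (\<Sum>q\<in>{i,k}. u q * g q) + (\<Sum>q\<in>E. u q * g q)"
        unfolding S_def using ik fin by (intro sum.union_disjoint) auto
      moreover have "(\<Sum>q\<in>D. x q * g q) = (\<Sum>q\<in>{i,k}. x q * g q)"
        by (rule sum.mono_neutral_right) (use fin ik in \<open>auto simp: x_def\<close>)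
      ultimately show ?thesis by (simp add: x_def y_def sum_negf)
    qed
    have tau: "sum u S = sum x D - sum y E" using split[of "\<lambda>_. 1"] by simp
    have sN: "(\<Sum>q\<in>F. z q * (norm (q - p))\<^sup>2) = sum z F - (\<Sum>q\<in>F. N q p * z q)" for F z p
      by (simp add: N_def algebra_simps sum_subtractf)
    have self: "(\<Sum>q\<in>F. N q p * z q) = z p" if F: "unit_regular_simplex d X F" and p: "p \<in> F" for F z p
    proof -
      have "(\<Sum>q\<in>F. N q p * z q) = (\<Sum>q\<in>F. if p = q then z q else 0)"
        by (rule sum.cong) (use simplex_sq_dist[OF F _ p] in \<open>auto simp: N_def\<close>)
      then show ?thesis using F p by (simp add: unit_regular_simplex_def)
    qed
    have Nsym: "N p q = N q p" for p q by (simp add: N_def norm_minus_commute)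
    have "coupled_weights D E N \<epsilon> x y (K - sum u S)"
      unfolding coupled_weights_def
    proof (intro conjI ballI)
      fix p assume p: "p \<in> D"
      have "K = (\<Sum>q\<in>D. x q * (norm (q - p))\<^sup>2) - (\<Sum>q\<in>E. y q * (norm (q - p))\<^sup>2)"
        unfolding split[symmetric] using u(2) p sub by auto
      also have "\<dots> = sum x D - x p - (sum y E - (\<Sum>q\<in>E. N q p * y q))"
        unfolding sN self[OF D p] ..
      finally show "x p = (\<Sum>q\<in>E. N p q * y q) - (K - sum u S)"
        using tau by (simp add: Nsym[of p])
    next
      fix p assume p: "p \<in> E"
      have "K = (\<Sum>q\<in>D. x q * (norm (q - p))\<^sup>2) - (\<Sum>q\<in>E. y q * (norm (q - p))\<^sup>2)"
        unfolding split[symmetric] using u(2) p sub by auto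
      also have "\<dots> = sum x D - (\<Sum>q\<in>D. N q p * x q) - (sum y E - y p)"
        unfolding sN self[OF E p] ..
      finally show "y p = (\<Sum>q\<in>D. N q p * x q) + (K - sum u S)"
        using tau by simp
    next
      show "sum x D - sum y E = \<epsilon> * (K - sum u S)" using u(3) tau by simp
    qed
    moreover have "\<forall>l\<in>D - {i,k}. x l = 0" by (simp add: x_def)
    moreover have "(\<exists>l\<in>D. x l \<noteq> 0) \<or> (\<exists>j\<in>E. y j \<noteq> 0)"
      using u(1) ik by (auto simp: S_def x_def y_def)
    ultimately show "\<exists>x y \<kappa>. coupled_weights D E N \<epsilon> x y \<kappa> \<and> (\<forall>l\<in>D - {i,k}. x l = 0) \<and>
        ((\<exists>l\<in>D. x l \<noteq> 0) \<or> (\<exists>j\<in>E. y j \<noteq> 0))" by blast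
  qed (use fin cards eps in auto)
qed

theorem mainTheorem2:
  fixes d :: nat and X \<Delta>\<^sub>1 \<Delta>\<^sub>2 :: "'a::euclidean_space set"
  assumes "d \<ge> 1"
    and "(DIM('a) = d \<and> X = UNIV) \<or>
         (DIM('a) = d + 1 \<and> (\<exists>c r. r > 1 / sqrt 2 \<and> X = sphere c r))"
    and "unit_regular_simplex d X \<Delta>\<^sub>1"
    and "unit_regular_simplex d X \<Delta>\<^sub>2"
  shows "int (card (\<Delta>\<^sub>1 \<inter> \<Delta>\<^sub>2)) \<ge> int d - 2 \<or>
         (\<exists>v\<^sub>1\<in>\<Delta>\<^sub>1. \<exists>v\<^sub>2\<in>\<Delta>\<^sub>2. norm (v\<^sub>1 - v\<^sub>2) > 1)"
proof (rule disjCI)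
  assume "\<not> (\<exists>v\<^sub>1\<in>\<Delta>\<^sub>1. \<exists>v\<^sub>2\<in>\<Delta>\<^sub>2. norm (v\<^sub>1 - v\<^sub>2) > 1)"
  then have close: "norm (p - q) \<le> 1" if "p \<in> \<Delta>\<^sub>1" "q \<in> \<Delta>\<^sub>2" for p q
    using that by (meson not_le)
  note D = assms(3) and E = assms(4)
  have fin: "finite \<Delta>\<^sub>1" "finite \<Delta>\<^sub>2" and cards: "card \<Delta>\<^sub>1 = d" "card \<Delta>\<^sub>2 = d"
    using D E by (auto simp: unit_regular_simplex_def)
  obtain \<epsilon> where eps: "\<epsilon> \<ge> 0" and wt: "\<And>S. finite S \<Longrightarrow> S \<subseteq> X \<Longrightarrow> card S = d + 2 \<Longrightarrow>
     \<exists>u K. (\<exists>q\<in>S. u q \<noteq> 0) \<and> (\<forall>p\<in>X. (\<Sum>q\<in>S. u q * (norm (q - p))\<^sup>2) = K) \<and>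
        sum u S = \<epsilon> * (K - sum u S)"
    using equidistance_weights[OF assms(2)] by blast
  have "(\<forall>p\<in>\<Delta>\<^sub>1. (\<Sum>q\<in>\<Delta>\<^sub>2. (1 - (norm (p - q))\<^sup>2)\<^sup>2) \<le> 1) \<or> (\<forall>q\<in>\<Delta>\<^sub>2. (\<Sum>p\<in>\<Delta>\<^sub>1. (1 - (norm (p - q))\<^sup>2)\<^sup>2) \<le> 1)"
    by (rule row_or_column[OF fin _ simplex_gap[OF D E]]) (use close in \<open>auto simp: power_le_one\<close>)
  then have "card (\<Delta>\<^sub>1 - \<Delta>\<^sub>2) \<le> 2 \<or> card (\<Delta>\<^sub>2 - \<Delta>\<^sub>1) \<le> 2"
  proof
    assume "\<forall>p\<in>\<Delta>\<^sub>1. (\<Sum>q\<in>\<Delta>\<^sub>2. (1 - (norm (p - q))\<^sup>2)\<^sup>2) \<le> 1"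
    then have "card (\<Delta>\<^sub>1 - \<Delta>\<^sub>2) \<le> 2"
      by (intro few_private_vertices[OF D E eps wt close]) auto
    then show ?thesis ..
  next
    assume "\<forall>q\<in>\<Delta>\<^sub>2. (\<Sum>p\<in>\<Delta>\<^sub>1. (1 - (norm (p - q))\<^sup>2)\<^sup>2) \<le> 1"
    moreover have "norm (q - p) \<le> 1" if "q \<in> \<Delta>\<^sub>2" "p \<in> \<Delta>\<^sub>1" for p q
      using close[OF that(2,1)] by (simp add: norm_minus_commute)
    ultimately have "card (\<Delta>\<^sub>2 - \<Delta>\<^sub>1) \<le> 2"
      by (intro few_private_vertices[OF E D eps wt]) (auto simp: norm_minus_commute)
    then show ?thesis ..
  qed
  then show "int (card (\<Delta>\<^sub>1 \<inter> \<Delta>\<^sub>2)) \<ge> int d - 2"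
    using card_Diff_subset_Int[of \<Delta>\<^sub>1 \<Delta>\<^sub>2] card_Diff_subset_Int[of \<Delta>\<^sub>2 \<Delta>\<^sub>1] fin cards
    by (auto simp: Int_commute)
qed

end
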